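(* Let $\alpha>0$ and let $v_\alpha(z)=(1-|z|^2)^\alpha$ for $z\in\mathbb{D}$. For every $\varepsilon>0$ there exist interpolating sequences for $\mathcal{B}_{v_\alpha}^\infty$ whose constant of separation is less than $\varepsilon$.
   Context: $\mathbb{D}$ is the open unit disk of $\mathbb{C}$ and $H(\mathbb{D})$ is the space of complex analytic functions on $\mathbb{D}$. For a weight (strictly positive continuous function) $v$ on $\mathbb{D}$, $$\mathcal{B}_v^\infty=\{f\in H(\mathbb{D}):\ \|f\|_{\mathcal{B}_v^\infty}:=|f(0)|+\sup_{z\in\mathbb{D}}v(z)|f'(z)|<\infty\}.$$ A sequence $(z_n)_{n\in\mathbb{N}}\subset\mathbb{D}$ is interpolating for $\mathcal{B}_v^\infty$ if for every bounded complex sequence $(a_n)\in\ell_\infty$ there exists $f\in\mathcal{B}_v^\infty$ such that $v(z_n)f'(z_n)=a_n$ for all $n\in\mathbb{N}$. The pseudohyperbolic distance on $\mathbb{D}$ is $\rho(z,w)=\left|\frac{z-w}{1-\bar z w}\right|$. A sequence $(z_n)\subset\mathbb{D}$ is separated if there is $\delta>0$ with $\rho(z_n,z_k)\ge\delta$ for all $n\ne k$, and its constant of separation is $r:=\inf_{n\ne k}\rho(z_n,z_k)$. *)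

theory Defs
  imports "HOL-Analysis.Analysis"
begin

abbreviation unit_disk :: "complex set"
  where "unit_disk \<equiv> ball 0 1"

definition weight :: "(complex \<Rightarrow> real) \<Rightarrow> bool"
  where "weight v \<longleftrightarrow> continuous_on unit_disk v \<and> (\<forall>z\<in>unit_disk. 0 < v z)"

(* Functions on the disk are total functions on the complex plane; only their values on the disk
   matter. The norm is extended-real valued, so that it is infinite when the supremum diverges. *)
definition Bloch_norm :: "(complex \<Rightarrow> real) \<Rightarrow> (complex \<Rightarrow> complex) \<Rightarrow> ereal"
  where "Bloch_norm v f =
    ereal (cmod (f 0)) + (SUP z\<in>unit_disk. ereal (v z * cmod (deriv f z)))"

definition Bloch_space :: "(complex \<Rightarrow> real) \<Rightarrow> (complex \<Rightarrow> complex) set"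
  where "Bloch_space v = {f. f holomorphic_on unit_disk \<and> Bloch_norm v f < \<infinity>}"

definition Bloch_interpolating :: "(complex \<Rightarrow> real) \<Rightarrow> (nat \<Rightarrow> complex) \<Rightarrow> bool"
  where "Bloch_interpolating v z \<longleftrightarrow>
    range z \<subseteq> unit_disk \<and>
    (\<forall>a :: nat \<Rightarrow> complex. bounded (range a) \<longrightarrow>
      (\<exists>f\<in>Bloch_space v. \<forall>n. complex_of_real (v (z n)) * deriv f (z n) = a n))"

definition pseudohyperbolic :: "complex \<Rightarrow> complex \<Rightarrow> real"
  where "pseudohyperbolic z w = cmod ((z - w) / (1 - cnj z * w))"

definition separated :: "(nat \<Rightarrow> complex) \<Rightarrow> bool"
  where "separated z \<longleftrightarrow>
    range z \<subseteq> unit_disk \<and>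
    (\<exists>\<delta>>0. \<forall>n k. n \<noteq> k \<longrightarrow> pseudohyperbolic (z n) (z k) \<ge> \<delta>)"

definition separation_constant :: "(nat \<Rightarrow> complex) \<Rightarrow> real"
  where "separation_constant z = Inf {pseudohyperbolic (z n) (z k) | n k. n \<noteq> k}"

definition standard_weight :: "real \<Rightarrow> complex \<Rightarrow> real"
  where "standard_weight \<alpha> z = (1 - (cmod z)\<^sup>2) powr \<alpha>"

lemma weight_standard_weight: "weight (standard_weight \<alpha>)"
proof -
  have pos: "0 < 1 - (cmod z)\<^sup>2" if "z \<in> unit_disk" for z
    using that by (simp add: power_less_one_iff abs_square_less_1)
  have "continuous_on unit_disk (\<lambda>z. (1 - (cmod z)\<^sup>2) powr \<alpha>)"
    by (intro continuous_intros) (use pos in force)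
  moreover have "0 < (1 - (cmod z)\<^sup>2) powr \<alpha>" if "z \<in> unit_disk" for z
    using pos[OF that] by simp
  ultimately show ?thesis
    unfolding weight_def standard_weight_def by blast
qed

end

theory Submission
  imports Defs "HOL-Complex_Analysis.Cauchy_Integral_Formula"
begin

text \<open>
  A bounded function times an interpolating function can be used to add one more point to an
  interpolating sequence, and nothing prevents the new point from being close to an old one. Hence
  a small separation constant costs nothing: take any interpolating sequence whose first point
  is \<open>0\<close>, and adjoin a point \<open>t > 0\<close> very close to \<open>0\<close>; the constant of separation is then
  at most \<open>\<rho> t 0 = t\<close>.

  Since \<open>f \<mapsto> f'\<close> maps the Bloch-type space onto the space of analytic \<open>g\<close> with
  \<open>v \<cdot> \<bar>g\<bar>\<close> bounded (the disk is convex, so primitives exist), it suffices to interpolate the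
  values \<open>v (z n) * g (z n)\<close> in the latter space.

  \<^emph>\<open>Adjoining a point\<close> (\<open>growth_interpolating_adjoin_near\<close>). Let \<open>g\<close> interpolate the data
  \<open>1, 0, 0, \<dots>\<close>. Then \<open>h x = (x - z 0) * g x\<close> vanishes at every \<open>z n\<close>, but at no point
  \<open>w \<noteq> z 0\<close> near \<open>z 0\<close>, because \<open>g (z 0) \<noteq> 0\<close>. Adding a multiple of \<open>h\<close> to a solution of the
  old problem adjusts the value at \<open>w\<close> at will without disturbing the others.

  \<^emph>\<open>A first interpolating sequence\<close> (\<open>geometric_radial_growth_interpolating\<close>). The points are
  \<open>1 - q ^ n\<close>. Each point \<open>w\<close> carries a peak function, a normalized power of the Cauchy kernel
  \<open>1 / (1 - cnj w * z)\<close>, and a solution is sought in the form of a series of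
  peaks with bounded coefficients. The weighted value of the \<open>n\<close>-th peak at the \<open>k\<close>-th point is
  at most a constant times \<open>(q powr \<alpha>) ^ \<bar>n - k\<bar>\<close>, and it is \<open>1\<close> for \<open>n = k\<close>. So for small \<open>q\<close> the
  coefficients solve a diagonally dominant infinite system, which is done by a Neumann
  series (\<open>diagonally_dominant_solvable\<close>).
\<close>

section \<open>Diagonally dominant infinite systems\<close>

text \<open>
  Writing \<open>M = I + E\<close>, the rows of \<open>E\<close> have \<open>\<ell>\<^sub>1\<close> norm at most \<open>\<theta>\<close>, so \<open>E\<close> has norm at most
  \<open>\<theta> < 1\<close> as an operator on bounded sequences, and \<open>c = \<Sum>j. (-E)\<^sup>j a\<close> solves \<open>M c = a\<close>.
\<close>

lemma diagonally_dominant_solvable: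
  fixes M :: "nat \<Rightarrow> nat \<Rightarrow> complex" and \<theta> :: real
  assumes \<theta>: "\<theta> < 1"
    and summ: "\<And>k. summable (\<lambda>n. cmod (M k n - of_bool (n = k)))"
    and le: "\<And>k. (\<Sum>n. cmod (M k n - of_bool (n = k))) \<le> \<theta>"
    and a: "bounded (range a)"
  obtains c where "bounded (range c)" "\<And>k. (\<lambda>n. M k n * c n) sums a k"
proof -
  define E where "E k n = M k n - of_bool (n = k)" for k n
  have summE: "summable (\<lambda>n. cmod (E k n))" and leE: "(\<Sum>n. cmod (E k n)) \<le> \<theta>" for k
    using summ le by (simp_all add: E_def)
  obtain A where A: "cmod (a k) \<le> A" for k
    using a by (auto simp: bounded_iff)
  have \<theta>0: "0 \<le> \<theta>"
    using leE[of 0] suminf_nonneg[OF summE[of 0]] by simp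
  have Esum: "summable (\<lambda>n. E k n * d n)" and Ebound: "cmod (\<Sum>n. E k n * d n) \<le> \<theta> * B"
    if "\<And>n. cmod (d n) \<le> B" for d B k
  proof -
    have le: "norm (E k n * d n) \<le> cmod (E k n) * B" for n
      by (simp add: norm_mult mult_left_mono that)
    have s: "summable (\<lambda>n. cmod (E k n) * B)"
      by (intro summable_mult2 summE)
    show "summable (\<lambda>n. E k n * d n)"
      by (rule summable_comparison_test'[OF s, of 0]) (rule le)
    have B0: "0 \<le> B"
      using that[of 0] norm_ge_zero order_trans by blast
    have "cmod (\<Sum>n. E k n * d n) \<le> (\<Sum>n. cmod (E k n) * B)"
      by (rule norm_suminf_le[OF le s])
    also have "\<dots> = (\<Sum>n. cmod (E k n)) * B"
      by (rule suminf_mult2[OF summE, symmetric])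
    also have "\<dots> \<le> \<theta> * B"
      by (rule mult_right_mono[OF leE B0])
    finally show "cmod (\<Sum>n. E k n * d n) \<le> \<theta> * B" .
  qed
  \<comment> \<open>\<open>d j\<close> is the \<open>j\<close>-th term \<open>(-E)\<^sup>j a\<close> of the Neumann series.\<close>
  define d where "d = rec_nat a (\<lambda>_ x k. - (\<Sum>n. E k n * x n))"
  have d0: "d 0 = a" and dSuc: "d (Suc j) k = - (\<Sum>n. E k n * d j n)" for j k
    by (simp_all add: d_def)
  have dle: "cmod (d j k) \<le> \<theta> ^ j * A" for j k
  proof (induction j arbitrary: k)
    case (Suc j)
    show ?case
      using Ebound[OF Suc.IH, of k] by (simp add: dSuc mult.assoc)
  qed (simp add: d0 A)
  have geo: "(\<lambda>j. \<theta> ^ (j + J) * A) sums (1 / (1 - \<theta>) * (\<theta> ^ J * A))" for J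
    using sums_mult2[OF geometric_sums[of \<theta>], of "\<theta> ^ J * A"] \<theta> \<theta>0
    by (simp add: power_add mult.assoc)
  have dsum: "summable (\<lambda>j. d j k)" for k
    by (rule summable_comparison_test'[OF sums_summable[OF geo[of 0]], of 0]) (use dle in simp)
  define c where "c k = (\<Sum>j. d j k)" for k
  have tail: "cmod (c k - (\<Sum>j<J. d j k)) \<le> 1 / (1 - \<theta>) * (\<theta> ^ J * A)" for J k
  proof -
    have "c k - (\<Sum>j<J. d j k) = (\<Sum>j. d (j + J) k)"
      unfolding c_def using suminf_split_initial_segment[OF dsum, of k J] by simp
    also have "cmod \<dots> \<le> (\<Sum>j. \<theta> ^ (j + J) * A)"
      by (rule norm_suminf_le[OF dle sums_summable[OF geo]])
    also have "\<dots> = 1 / (1 - \<theta>) * (\<theta> ^ J * A)"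
      by (rule sums_unique[OF geo, symmetric])
    finally show ?thesis .
  qed
  have cle: "cmod (c k) \<le> 1 / (1 - \<theta>) * A" for k
    using tail[of k 0] by simp
  have Ec: "(\<Sum>n. E k n * c n) = a k - c k" for k
  proof -
    \<comment> \<open>The row \<open>E k\<close> applied to the tail of the Neumann series is estimated by the tail itself;
      this replaces an interchange of the two summations.\<close>
    define R where "R J = (\<Sum>n. E k n * (c n - (\<Sum>j<J. d j n)))" for J
    have "(\<lambda>J. \<theta> * (1 / (1 - \<theta>) * (\<theta> ^ J * A))) \<longlonglongrightarrow> \<theta> * (1 / (1 - \<theta>) * (0 * A))"
      using \<theta> \<theta>0 by (intro tendsto_intros LIMSEQ_power_zero) auto
    moreover have "cmod (R J) \<le> \<theta> * (1 / (1 - \<theta>) * (\<theta> ^ J * A))" for J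
      unfolding R_def by (rule Ebound[OF tail])
    ultimately have "R \<longlonglongrightarrow> 0"
      by (intro Lim_null_comparison[of R]) simp_all
    moreover have "R J = (\<Sum>n. E k n * c n) - a k + (\<Sum>j<Suc J. d j k)" for J
    proof -
      have s: "(\<lambda>n. \<Sum>j<J. E k n * d j n) sums (\<Sum>j<J. \<Sum>n. E k n * d j n)"
        by (intro sums_sum summable_sums Esum[OF dle])
      have "R J = (\<Sum>n. E k n * c n - (\<Sum>j<J. E k n * d j n))"
        unfolding R_def by (simp add: right_diff_distrib sum_distrib_left)
      also have "\<dots> = (\<Sum>n. E k n * c n) - (\<Sum>j<J. \<Sum>n. E k n * d j n)"
        using sums_unique[OF sums_diff[OF summable_sums[OF Esum[OF cle]] s]] by simp
      also have "(\<Sum>j<J. \<Sum>n. E k n * d j n) = a k - (\<Sum>j<Suc J. d j k)"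
        by (simp add: sum.lessThan_Suc_shift dSuc d0 sum_negf del: sum.lessThan_Suc)
      finally show ?thesis
        by simp
    qed
    moreover have "(\<lambda>J. (\<Sum>n. E k n * c n) - a k + (\<Sum>j<Suc J. d j k))
        \<longlonglongrightarrow> (\<Sum>n. E k n * c n) - a k + c k"
      unfolding c_def by (intro tendsto_intros LIMSEQ_Suc summable_LIMSEQ dsum)
    ultimately have "(\<Sum>n. E k n * c n) - a k + c k = 0"
      by (metis (no_types, lifting) LIMSEQ_unique ext)
    then show ?thesis
      by (simp add: algebra_simps)
  qed
  have "(\<lambda>n. M k n * c n) sums a k" for k
  proof -
    have "(\<lambda>n. E k n * c n) sums (a k - c k)"
      using summable_sums[OF Esum[of c, OF cle], of k] by (simp add: Ec)
    from sums_add[OF this sums_single[of k c]]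
    have "(\<lambda>n. E k n * c n + (if n = k then c n else 0)) sums a k"
      by simp
    moreover have "(\<lambda>n. E k n * c n + (if n = k then c n else 0)) = (\<lambda>n. M k n * c n)"
      by (auto simp: E_def algebra_simps)
    ultimately show ?thesis
      by simp
  qed
  moreover have "bounded (range c)"
    using cle by (auto intro!: boundedI)
  ultimately show thesis
    using that by blast
qed

text \<open>
  With truncated subtraction, \<open>(n - k) + (k - n)\<close> is the distance \<open>\<bar>n - k\<bar>\<close>. The bound is the
  value of the corresponding sum over all integers \<open>n\<close>.
\<close>

lemma two_sided_geometric_sums:
  fixes p :: real and k :: nat
  assumes "0 \<le> p" "p < 1"
  shows "summable (\<lambda>n. p ^ ((n - k) + (k - n)))"
    and "(\<Sum>n. p ^ ((n - k) + (k - n))) \<le> (1 + p) / (1 - p)"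
proof -
  let ?f = "\<lambda>n. p ^ ((n - k) + (k - n))"
  have tail: "(\<lambda>n. ?f (n + k)) sums (1 / (1 - p))"
    using geometric_sums[of p] assms by simp
  then have sums: "?f sums (1 / (1 - p) + (\<Sum>n<k. ?f n))"
    by (subst (asm) sums_iff_shift)
  then show "summable ?f"
    by (rule sums_summable)
  have "(\<Sum>n<k. ?f n) = (\<Sum>n<k. p ^ (k - n))"
    by (intro sum.cong) auto
  also have "\<dots> = (\<Sum>n<k. p * p ^ n)"
    by (subst sum.nat_diff_reindex[symmetric])
       (auto intro!: sum.cong simp flip: power_Suc)
  also have "\<dots> \<le> p * (1 / (1 - p))"
    using assms sums_unique[OF geometric_sums[of p]]
      sum_le_suminf[OF sums_summable[OF geometric_sums[of p]], of "{..<k}"]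
    by (auto simp: sum_distrib_left[symmetric] intro!: mult_left_mono)
  finally show "(\<Sum>n. ?f n) \<le> (1 + p) / (1 - p)"
    using sums_unique[OF sums] assms by (simp add: add_divide_distrib)
qed

section \<open>Growth spaces\<close>

definition growth_space :: "(complex \<Rightarrow> real) \<Rightarrow> (complex \<Rightarrow> complex) set"
  where "growth_space v =
    {g. g holomorphic_on unit_disk \<and> (\<exists>C. \<forall>x\<in>unit_disk. v x * cmod (g x) \<le> C)}"

definition growth_interpolating :: "(complex \<Rightarrow> real) \<Rightarrow> (nat \<Rightarrow> complex) \<Rightarrow> bool"
  where "growth_interpolating v z \<longleftrightarrow>
    range z \<subseteq> unit_disk \<and>
    (\<forall>a :: nat \<Rightarrow> complex. bounded (range a) \<longrightarrow>
      (\<exists>g\<in>growth_space v. \<forall>n. complex_of_real (v (z n)) * g (z n) = a n))"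

lemma growth_interpolating_imp_Bloch_interpolating:
  assumes "growth_interpolating v z"
  shows "Bloch_interpolating v z"
  unfolding Bloch_interpolating_def
proof (intro conjI allI impI)
  show z: "range z \<subseteq> unit_disk"
    using assms by (simp add: growth_interpolating_def)
  fix a :: "nat \<Rightarrow> complex"
  assume "bounded (range a)"
  then obtain g where "g \<in> growth_space v"
      and ga: "\<And>n. complex_of_real (v (z n)) * g (z n) = a n"
    using assms unfolding growth_interpolating_def by meson
  then obtain C where g: "g holomorphic_on unit_disk"
      and C: "\<And>x. x \<in> unit_disk \<Longrightarrow> v x * cmod (g x) \<le> C"
    unfolding growth_space_def by blast
  obtain f where f: "\<And>x. x \<in> unit_disk \<Longrightarrow> (f has_field_derivative g x) (at x within unit_disk)"
    using holomorphic_convex_primitive'[OF convex_ball open_ball g] by blast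
  then have f': "deriv f x = g x" if "x \<in> unit_disk" for x
    using that by (metis DERIV_imp_deriv at_within_open open_ball)
  have "f holomorphic_on unit_disk"
    using f by (meson holomorphic_on_open field_differentiable_def holomorphic_onI)
  moreover have "(SUP x\<in>unit_disk. ereal (v x * cmod (deriv f x))) \<le> ereal C"
    by (rule SUP_least) (use C f' in simp)
  then have "Bloch_norm v f < \<infinity>"
    unfolding Bloch_norm_def by (auto simp: ereal_infty_less)
  ultimately have "f \<in> Bloch_space v"
    by (simp add: Bloch_space_def)
  moreover have "complex_of_real (v (z n)) * deriv f (z n) = a n" for n
    using z ga[of n] f'[of "z n"] by (simp add: image_subset_iff)
  ultimately show "\<exists>f\<in>Bloch_space v. \<forall>n. complex_of_real (v (z n)) * deriv f (z n) = a n"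
    by blast
qed

lemma growth_space_add:
  assumes "f \<in> growth_space v" "g \<in> growth_space v" "\<And>x. x \<in> unit_disk \<Longrightarrow> 0 < v x"
  shows "(\<lambda>x. f x + g x) \<in> growth_space v"
proof -
  obtain C D where C: "\<And>x. x \<in> unit_disk \<Longrightarrow> v x * cmod (f x) \<le> C"
      and D: "\<And>x. x \<in> unit_disk \<Longrightarrow> v x * cmod (g x) \<le> D"
    using assms unfolding growth_space_def by blast
  have "v x * cmod (f x + g x) \<le> C + D" if "x \<in> unit_disk" for x
  proof -
    have "v x * cmod (f x + g x) \<le> v x * (cmod (f x) + cmod (g x))"
      using assms(3)[OF that] by (intro mult_left_mono norm_triangle_ineq) simp
    also have "\<dots> \<le> C + D"
      using C[OF that] D[OF that] by (simp add: distrib_left)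
    finally show ?thesis .
  qed
  with assms(1,2) show ?thesis
    unfolding growth_space_def by (auto intro!: holomorphic_intros exI[of _ "C + D"])
qed

lemma growth_space_mult_bounded:
  assumes g: "g \<in> growth_space v" and b: "b holomorphic_on unit_disk"
    and B: "\<And>x. x \<in> unit_disk \<Longrightarrow> cmod (b x) \<le> B" and v: "\<And>x. x \<in> unit_disk \<Longrightarrow> 0 < v x"
  shows "(\<lambda>x. b x * g x) \<in> growth_space v"
proof -
  obtain C where C: "\<And>x. x \<in> unit_disk \<Longrightarrow> v x * cmod (g x) \<le> C"
    using g unfolding growth_space_def by blast
  have "v x * cmod (b x * g x) \<le> B * C" if "x \<in> unit_disk" for x
  proof -
    have "v x * cmod (b x * g x) = cmod (b x) * (v x * cmod (g x))"
      by (simp add: norm_mult)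
    also have "\<dots> \<le> B * C"
      using v[OF that] order_trans[OF norm_ge_zero B[OF that]]
      by (intro mult_mono B C that) auto
    finally show ?thesis .
  qed
  with g b show ?thesis
    unfolding growth_space_def by (auto intro!: holomorphic_intros exI[of _ "B * C"])
qed

text \<open>
  The new point may be taken as close to an old one as desired. The price is the size of the
  solutions, since \<open>h w\<close> in the proof tends to \<open>0\<close> as \<open>w\<close> approaches \<open>z 0\<close>; but only their existence
  is at stake.
\<close>

lemma growth_interpolating_adjoin_near:
  assumes z: "growth_interpolating v z" and v: "\<And>x. x \<in> unit_disk \<Longrightarrow> 0 < v x"
  shows "\<forall>\<^sub>F w in at (z 0). growth_interpolating v (case_nat w z)"
proof -
  have zD: "z n \<in> unit_disk" for n
    using z unfolding growth_interpolating_def by blast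
  have interp: "\<exists>g\<in>growth_space v. \<forall>n. complex_of_real (v (z n)) * g (z n) = a n"
    if "bounded (range a)" for a
    using z that unfolding growth_interpolating_def by blast
  have "bounded (range (\<lambda>n. of_bool (n = 0) :: complex))"
    by (rule boundedI[of _ 1]) auto
  from interp[OF this] obtain g where g: "g \<in> growth_space v"
    and gz: "\<And>n. complex_of_real (v (z n)) * g (z n) = of_bool (n = 0)"
    by blast
  have g0: "g (z 0) \<noteq> 0"
    using gz[of 0] by auto
  have gn: "g (z n) = 0" if "n \<noteq> 0" for n
    using gz[of n] v[OF zD[of n]] that by simp
  have "continuous_on unit_disk g"
    using g unfolding growth_space_def by (auto intro: holomorphic_on_imp_continuous_on)
  then have "isCont g (z 0)"
    using zD[of 0] by (simp only: continuous_on_eq_continuous_at[OF open_ball])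
  then have "\<forall>\<^sub>F w in at (z 0). g w \<noteq> 0"
    using g0 by (auto simp: isCont_def intro: tendsto_imp_eventually_ne)
  moreover have "\<forall>\<^sub>F w in at (z 0). w \<in> unit_disk"
    by (rule eventually_at_in_open') (use zD in auto)
  moreover have "\<forall>\<^sub>F w in at (z 0). w \<noteq> z 0"
    by (simp add: eventually_at_filter)
  ultimately show ?thesis
  proof eventually_elim
    case (elim w)
    define h where "h x = (x - z 0) * g x" for x
    have hz: "h (z n) = 0" for n
      using gn[of n] by (cases "n = 0") (auto simp: h_def)
    have hw: "h w \<noteq> 0"
      using elim by (simp add: h_def)
    show ?case
      unfolding growth_interpolating_def
    proof (intro conjI allI impI)
      show "range (case_nat w z) \<subseteq> unit_disk"
        using elim zD by (auto split: nat.splits)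
      fix a :: "nat \<Rightarrow> complex"
      assume "bounded (range a)"
      then have "bounded (range (\<lambda>n. a (Suc n)))"
        by (rule bounded_subset) auto
      from interp[OF this] obtain f where f: "f \<in> growth_space v"
        and fz: "\<And>n. complex_of_real (v (z n)) * f (z n) = a (Suc n)"
        by blast
      define c where "c = (a 0 / complex_of_real (v w) - f w) / h w"
      have "(\<lambda>x. (c * (x - z 0)) * g x) \<in> growth_space v"
      proof (rule growth_space_mult_bounded[OF g _ _ v])
        show "cmod (c * (x - z 0)) \<le> cmod c * 2" if "x \<in> unit_disk" for x
          unfolding norm_mult using that zD[of 0] norm_triangle_ineq4[of x "z 0"]
          by (intro mult_left_mono) auto
      qed (auto intro!: holomorphic_intros)
      from growth_space_add[OF f this v]
      have "(\<lambda>x. f x + c * h x) \<in> growth_space v"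
        by (simp add: h_def mult.assoc)
      moreover have "complex_of_real (v (case_nat w z n)) *
          (f (case_nat w z n) + c * h (case_nat w z n)) = a n" for n
        using hz fz v[of w] elim hw
        by (cases n) (auto simp: c_def)
      ultimately show "\<exists>g\<in>growth_space v. \<forall>n.
          complex_of_real (v (case_nat w z n)) * g (case_nat w z n) = a n"
        by (intro bexI[of _ "\<lambda>x. f x + c * h x"]) simp_all
    qed
  qed
qed

section \<open>Peak functions\<close>

text \<open>
  The numerator makes the weighted value at the centre \<open>w\<close> equal to \<open>1\<close> for the weight
  \<open>standard_weight \<alpha>\<close>. The exponent \<open>m\<close> is a natural number to keep the function a rational one.
\<close>

definition peak :: "real \<Rightarrow> nat \<Rightarrow> complex \<Rightarrow> complex \<Rightarrow> complex"
  where "peak \<alpha> m w z =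
    complex_of_real ((1 - (cmod w)\<^sup>2) powr (real m - \<alpha>)) / (1 - cnj w * z) ^ m"

lemma one_minus_cnj_mult_bound:
  assumes "z \<in> unit_disk" "w \<in> unit_disk"
  shows "max (1 - cmod z) (1 - cmod w) \<le> cmod (1 - cnj w * z)"
proof -
  have "cmod w * cmod z \<le> cmod z" "cmod w * cmod z \<le> cmod w"
    using assms by (simp_all add: mult_left_le_one_le mult_left_le)
  moreover have "1 - cmod w * cmod z \<le> cmod (1 - cnj w * z)"
    using norm_triangle_ineq2[of 1 "cnj w * z"] by (simp add: norm_mult)
  ultimately show ?thesis
    by simp
qed

lemma peak_holomorphic:
  assumes "w \<in> unit_disk"
  shows "peak \<alpha> m w holomorphic_on unit_disk"
proof -
  have "1 - cnj w * z \<noteq> 0" if "z \<in> unit_disk" for z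
    using one_minus_cnj_mult_bound[OF that assms] that by auto
  then show ?thesis
    unfolding peak_def by (intro holomorphic_intros) auto
qed

lemma standard_weight_pos:
  assumes "z \<in> unit_disk"
  shows "0 < standard_weight \<alpha> z"
  using weight_standard_weight assms unfolding weight_def by blast

lemma peak_at_centre:
  assumes "w \<in> unit_disk"
  shows "complex_of_real (standard_weight \<alpha> w) * peak \<alpha> m w w = 1"
proof -
  have pos: "0 < 1 - (cmod w)\<^sup>2"
    using assms by (simp add: power_less_one_iff)
  have "1 - cnj w * w = complex_of_real (1 - (cmod w)\<^sup>2)"
    using complex_norm_square[of w] by (simp add: mult.commute)
  then have "complex_of_real (standard_weight \<alpha> w) * peak \<alpha> m w w =
      complex_of_real ((1 - (cmod w)\<^sup>2) powr \<alpha> * (1 - (cmod w)\<^sup>2) powr (real m - \<alpha>) /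
        (1 - (cmod w)\<^sup>2) ^ m)"
    unfolding peak_def standard_weight_def by (simp only: of_real_mult of_real_divide of_real_power) simp
  also have "(1 - (cmod w)\<^sup>2) powr \<alpha> * (1 - (cmod w)\<^sup>2) powr (real m - \<alpha>) = (1 - (cmod w)\<^sup>2) ^ m"
    using pos by (simp flip: powr_add add: powr_realpow)
  finally show ?thesis
    using pos by simp
qed

text \<open>
  With \<open>L = max s t\<close>, the left-hand side is at most
  \<open>2 ^ m * (s / L) powr \<alpha> * (t / L) powr (m - \<alpha>)\<close>. One of the two factors is \<open>1\<close>, and
  \<open>m \<ge> 2 * \<alpha>\<close> ensures that the weighted peak decays at least as fast when \<open>z\<close> moves away from the boundary as
  when it moves towards it, so that both cases are covered by the same power \<open>\<alpha>\<close>.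
\<close>

lemma peak_growth:
  assumes \<alpha>: "0 < \<alpha>" and m: "2 * \<alpha> \<le> real m"
    and z: "z \<in> unit_disk" and w: "w \<in> unit_disk"
  defines "s \<equiv> 1 - cmod z" and "t \<equiv> 1 - cmod w"
  shows "standard_weight \<alpha> z * cmod (peak \<alpha> m w z) \<le> 2 ^ m * (min s t / max s t) powr \<alpha>"
proof -
  define L where "L = max s t"
  have s: "0 < s" and t: "0 < t" and L: "0 < L" "s \<le> L" "t \<le> L"
    using z w by (auto simp: s_def t_def L_def)
  have sq: "0 \<le> 1 - (cmod x)\<^sup>2" "1 - (cmod x)\<^sup>2 \<le> 2 * (1 - cmod x)" if "x \<in> unit_disk" for x
  proof -
    show "0 \<le> 1 - (cmod x)\<^sup>2"
      using that by (simp add: power_le_one)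
    show "1 - (cmod x)\<^sup>2 \<le> 2 * (1 - cmod x)"
      using zero_le_power2[of "1 - cmod x"] by (simp add: power2_diff)
  qed
  have "standard_weight \<alpha> z * cmod (peak \<alpha> m w z) =
      (1 - (cmod z)\<^sup>2) powr \<alpha> * (1 - (cmod w)\<^sup>2) powr (real m - \<alpha>) / cmod (1 - cnj w * z) ^ m"
    by (simp add: standard_weight_def peak_def norm_divide norm_power)
  also have "\<dots> \<le> (2 * s) powr \<alpha> * (2 * t) powr (real m - \<alpha>) / L ^ m"
    using \<alpha> m sq[OF z] sq[OF w] L one_minus_cnj_mult_bound[OF z w] s t
    by (intro frac_le mult_mono powr_mono2 power_mono) (auto simp: s_def t_def L_def)
  also have "\<dots> = 2 ^ m * ((s / L) powr \<alpha> * (t / L) powr (real m - \<alpha>))"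
  proof -
    have split: "x ^ m = x powr \<alpha> * x powr (real m - \<alpha>)" if "0 < x" for x :: real
      using that by (simp flip: powr_add add: powr_realpow)
    show ?thesis
      using s t L split[of L] split[of 2] by (simp add: powr_mult powr_divide field_simps)
  qed
  also have "(s / L) powr \<alpha> * (t / L) powr (real m - \<alpha>) \<le> (min s t / max s t) powr \<alpha>"
  proof (cases "s \<le> t")
    case True
    then show ?thesis
      using t by (simp add: L_def)
  next
    case False
    then have "(t / s) powr (real m - \<alpha>) \<le> (t / s) powr \<alpha>"
      using s t m by (intro powr_mono') auto
    with False s show ?thesis
      by (simp add: L_def)
  qed
  finally show ?thesis
    by simp
qed

section \<open>Geometric radial sequences\<close>

lemma geometric_bracket:
  fixes q s :: real
  assumes "0 < q" "q < 1" "0 < s" "s \<le> 1"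
  obtains k where "q ^ Suc k \<le> s" "s \<le> q ^ k"
proof -
  obtain n where n: "q ^ n < s"
    using real_arch_pow_inv[OF assms(3,2)] by blast
  define l where "l = (LEAST n. q ^ n < s)"
  have l: "q ^ l < s"
    unfolding l_def using n by (rule LeastI)
  then obtain k where k: "l = Suc k"
    using assms by (cases l) auto
  then have "\<not> q ^ k < s"
    using not_less_Least[of k "\<lambda>n. q ^ n < s"] by (simp add: l_def)
  with l k show thesis
    by (intro that[of k]) auto
qed

lemma min_div_max_powers:
  fixes q :: real
  assumes "0 < q" "q < 1"
  shows "min (q ^ k) (q ^ n) / max (q ^ k) (q ^ n) = q ^ ((n - k) + (k - n))"
proof (cases "n \<le> k")
  case True
  then have "q ^ k \<le> q ^ n"
    using assms by (intro power_decreasing) auto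
  with True show ?thesis
    using assms by (simp add: power_diff)
next
  case False
  then have "q ^ n \<le> q ^ k"
    using assms by (intro power_decreasing) auto
  with False show ?thesis
    using assms by (simp add: power_diff min_def max_def)
qed

text \<open>
  A point at distance \<open>s\<close> from the circle interacts with the geometric sequence like its nearest
  members do, up to the factor \<open>1 / q\<close>. This reduces the estimate on the whole disk to a
  two-sided geometric series.
\<close>

lemma min_div_max_bracket:
  fixes q s :: real
  assumes q: "0 < q" "q < 1" and s: "q ^ Suc k \<le> s" "s \<le> q ^ k"
  shows "min s (q ^ n) / max s (q ^ n) \<le> q ^ ((n - k) + (k - n)) / q"
proof (cases "n \<le> k")
  case True
  then have "q ^ k \<le> q ^ n"
    using q by (intro power_decreasing) auto
  with s have "min s (q ^ n) / max s (q ^ n) = s / q ^ n"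
    by simp
  also have "\<dots> \<le> q ^ k / q ^ n"
    using q s by (intro divide_right_mono) auto
  also have "\<dots> = q ^ ((n - k) + (k - n))"
    using True q by (simp add: power_diff)
  also have "\<dots> \<le> q ^ ((n - k) + (k - n)) / q"
    using q by (simp add: le_divide_eq mult_left_le)
  finally show ?thesis .
next
  case False
  then have "q ^ n \<le> q ^ Suc k"
    using q by (intro power_decreasing) auto
  from this s(1) have "q ^ n \<le> s"
    by (rule order_trans)
  then have "min s (q ^ n) / max s (q ^ n) = q ^ n / s"
    by simp
  also have "\<dots> \<le> q ^ n / q ^ Suc k"
    using q s(1) by (intro frac_le) auto
  also have "\<dots> = q ^ ((n - k) + (k - n)) / q"
    using False q by (simp add: power_diff)
  finally show ?thesis .
qed

text \<open>
  The quantity required to be less than \<open>1\<close> is \<open>2 ^ m\<close>, the constant of \<open>peak_growth\<close>, times the sum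
  of \<open>(q powr \<alpha>) ^ \<bar>j\<bar>\<close> over the integers \<open>j \<noteq> 0\<close>. It bounds the sum of the moduli of the off-diagonal entries in
  every row of the matrix of weighted values of the peaks at the points.
\<close>

lemma geometric_radial_growth_interpolating:
  assumes \<alpha>: "0 < \<alpha>" and m: "2 * \<alpha> \<le> real m" and q: "0 < q" "q < 1"
    and small: "2 ^ m * (2 * q powr \<alpha> / (1 - q powr \<alpha>)) < 1"
  shows "growth_interpolating (standard_weight \<alpha>) (\<lambda>n. complex_of_real (1 - q ^ n))"
  unfolding growth_interpolating_def
proof (intro conjI allI impI)
  define w where "w n = complex_of_real (1 - q ^ n)" for n
  define p where "p = q powr \<alpha>"
  define v where "v = standard_weight \<alpha>"
  define K where "K n z = peak \<alpha> m (w n) z" for n z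
  define D where "D k n = (n - k) + (k - n)" for k n :: nat
  have p: "0 < p" "p < 1"
    using q \<alpha> powr_less_mono2[of \<alpha> q 1] by (auto simp: p_def)
  have pp: "(q ^ j) powr \<alpha> = p ^ j" for j
    using q by (simp add: p_def powr_powr mult.commute flip: powr_realpow)
  have norm_w: "cmod (w n) = 1 - q ^ n" for n
    unfolding w_def norm_of_real using q by (simp add: power_le_one)
  have wD: "w n \<in> unit_disk" for n
    using q by (simp add: norm_w)
  then show "range (\<lambda>n. complex_of_real (1 - q ^ n)) \<subseteq> unit_disk"
    unfolding w_def by blast
  have vpos: "0 < v z" if "z \<in> unit_disk" for z
    unfolding v_def by (rule standard_weight_pos[OF that])
  have growth: "v z * cmod (K n z) \<le>
      2 ^ m * (min (1 - cmod z) (q ^ n) / max (1 - cmod z) (q ^ n)) powr \<alpha>"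
    if "z \<in> unit_disk" for z n
    using peak_growth[OF \<alpha> m that wD[of n]] by (simp add: v_def K_def norm_w)
  have Dsum: "summable (\<lambda>n. p ^ D k n)" "(\<Sum>n. p ^ D k n) \<le> (1 + p) / (1 - p)" for k
    using two_sided_geometric_sums[of p k] p by (simp_all add: D_def)

  fix a :: "nat \<Rightarrow> complex"
  assume a: "bounded (range a)"
  define M where "M k n = complex_of_real (v (w k)) * K n (w k)" for k n
  have Mdiff: "cmod (M k n - of_bool (n = k)) \<le> 2 ^ m * (p ^ D k n - of_bool (n = k))" for k n
  proof (cases "n = k")
    case True
    then show ?thesis
      using peak_at_centre[OF wD[of k]] by (simp add: M_def K_def v_def D_def)
  next
    case False
    have "cmod (M k n) = v (w k) * cmod (K n (w k))"
      using vpos[OF wD[of k]] by (simp add: M_def norm_mult)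
    also have "\<dots> \<le> 2 ^ m * p ^ D k n"
      using growth[OF wD[of k], of n] min_div_max_powers[OF q, of k n]
      by (simp add: norm_w pp D_def)
    finally show ?thesis
      using False by simp
  qed
  have ident: "(\<lambda>n. of_bool (n = k) :: real) sums 1" for k
    using sums_single[of k "\<lambda>_. 1 :: real"] by (simp add: of_bool_def)
  have maj: "(\<lambda>n. 2 ^ m * (p ^ D k n - of_bool (n = k))) sums (2 ^ m * ((\<Sum>n. p ^ D k n) - 1))" for k
    by (intro sums_mult sums_diff summable_sums Dsum ident)
  have Msum: "summable (\<lambda>n. cmod (M k n - of_bool (n = k)))" for k
    by (rule summable_comparison_test'[OF sums_summable[OF maj[of k]], of 0])
       (simp only: real_norm_def abs_norm_cancel Mdiff)
  have "(\<Sum>n. cmod (M k n - of_bool (n = k))) \<le> 2 ^ m * (2 * p / (1 - p))" for k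
  proof -
    have "(\<Sum>n. cmod (M k n - of_bool (n = k))) \<le> 2 ^ m * ((\<Sum>n. p ^ D k n) - 1)"
      using suminf_le[OF Mdiff Msum sums_summable[OF maj]] sums_unique[OF maj] by simp
    also have "\<dots> \<le> 2 ^ m * ((1 + p) / (1 - p) - 1)"
      using Dsum(2) by (intro mult_left_mono diff_right_mono) auto
    also have "(1 + p) / (1 - p) - 1 = 2 * p / (1 - p)"
      using p by (simp add: field_simps)
    finally show ?thesis .
  qed
  from diagonally_dominant_solvable[OF small[folded p_def] Msum this a]
  obtain c where c: "bounded (range c)" and Mc: "\<And>k. (\<lambda>n. M k n * c n) sums a k"
    by blast
  obtain B where B: "cmod (c n) \<le> B" for n
    using c by (auto simp: bounded_iff)
  have B0: "0 \<le> B"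
    using B[of 0] norm_ge_zero order_trans by blast
  define g where "g z = (\<Sum>n. c n * K n z)" for z

  \<comment> \<open>The same two-sided geometric series controls the growth at every point of the disk.\<close>
  have bound: "v z * cmod (g z) \<le> B * (2 ^ m / p) * ((1 + p) / (1 - p))" if z: "z \<in> unit_disk" for z
  proof -
    obtain k where k: "q ^ Suc k \<le> 1 - cmod z" "1 - cmod z \<le> q ^ k"
      using geometric_bracket[OF q, of "1 - cmod z"] z by auto
    have term_le: "cmod (complex_of_real (v z) * (c n * K n z)) \<le> B * (2 ^ m / p) * p ^ D k n" for n
    proof -
      have "v z * cmod (K n z) \<le> 2 ^ m * (q ^ D k n / q) powr \<alpha>"
        using min_div_max_bracket[OF q k, of n] q z \<alpha>
        by (intro order_trans[OF growth[OF z]] mult_left_mono powr_mono2) (auto simp: D_def)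
      also have "\<dots> = 2 ^ m / p * p ^ D k n"
        using q by (simp add: powr_divide pp) (simp add: p_def)
      finally have "cmod (c n) * (v z * cmod (K n z)) \<le> B * (2 ^ m / p * p ^ D k n)"
        using B0 vpos[OF z] by (intro mult_mono[OF B]) auto
      then show ?thesis
        using vpos[OF z] by (simp add: norm_mult mult_ac)
    qed
    have s: "summable (\<lambda>n. B * (2 ^ m / p) * p ^ D k n)"
      by (intro summable_mult Dsum)
    have "summable (\<lambda>n. complex_of_real (v z) * (c n * K n z))"
      by (rule summable_comparison_test'[OF s, of 0]) (rule term_le)
    then have "complex_of_real (v z) * g z = (\<Sum>n. complex_of_real (v z) * (c n * K n z))"
      using vpos[OF z] by (simp add: g_def suminf_mult summable_cmult_iff)
    then have "v z * cmod (g z) = cmod (\<Sum>n. complex_of_real (v z) * (c n * K n z))"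
      using vpos[OF z] by (metis abs_of_pos norm_mult norm_of_real)
    also have "\<dots> \<le> (\<Sum>n. B * (2 ^ m / p) * p ^ D k n)"
      by (rule norm_suminf_le[OF term_le s])
    also have "\<dots> = B * (2 ^ m / p) * (\<Sum>n. p ^ D k n)"
      by (rule suminf_mult[OF Dsum(1)])
    also have "\<dots> \<le> B * (2 ^ m / p) * ((1 + p) / (1 - p))"
      using B0 p by (intro mult_left_mono Dsum) auto
    finally show ?thesis .
  qed

  have hol: "g holomorphic_on unit_disk"
  proof (rule holomorphic_uniform_sequence[OF open_ball])
    show "(\<lambda>z. \<Sum>n<N. c n * K n z) holomorphic_on unit_disk" for N
      unfolding K_def by (intro holomorphic_intros peak_holomorphic wD)
    fix x :: complex
    assume x: "x \<in> unit_disk"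
    define d where "d = (1 - cmod x) / 2"
    have d: "0 < d"
      using x by (simp add: d_def)
    have far: "d \<le> 1 - cmod z" if "z \<in> cball x d" for z
      using that norm_triangle_ineq2[of z x] by (simp add: d_def dist_norm norm_minus_commute)
    then have sub: "cball x d \<subseteq> unit_disk"
      using d by force
    have "uniform_limit (cball x d) (\<lambda>N z. \<Sum>n<N. c n * K n z) g sequentially"
      unfolding g_def
      \<comment> \<open>On a fixed disk \<open>v\<close> is bounded below, and the decay of the peaks in \<open>n\<close> is geometric.\<close>
    proof (rule Weierstrass_m_test)
      show "summable (\<lambda>n. B * (2 ^ m / (d powr \<alpha>)\<^sup>2) * p ^ n)"
        using p by (intro summable_mult summable_geometric) auto
      fix n z
      assume zx: "z \<in> cball x d"
      then have z: "z \<in> unit_disk" and dz: "d \<le> 1 - cmod z"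
        using sub far by auto
      have "1 - cmod z \<le> 1 - (cmod z)\<^sup>2"
        using z by (simp add: power2_eq_square mult_left_le)
      then have "d powr \<alpha> \<le> v z"
        unfolding v_def standard_weight_def using d dz \<alpha> by (intro powr_mono2) auto
      then have "d powr \<alpha> * cmod (K n z) \<le> v z * cmod (K n z)"
        by (intro mult_right_mono) auto
      also have "\<dots> \<le> 2 ^ m * (q ^ n / d) powr \<alpha>"
        using q d dz \<alpha>
        by (intro order_trans[OF growth[OF z]] mult_left_mono powr_mono2 frac_le) auto
      also have "\<dots> = 2 ^ m * p ^ n / d powr \<alpha>"
        using q d by (simp add: powr_divide pp)
      finally have "cmod (K n z) \<le> 2 ^ m / (d powr \<alpha>)\<^sup>2 * p ^ n"
        using d by (simp add: field_simps power2_eq_square)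
      then have "cmod (c n) * cmod (K n z) \<le> B * (2 ^ m / (d powr \<alpha>)\<^sup>2 * p ^ n)"
        using B0 by (intro mult_mono B) auto
      then show "cmod (c n * K n z) \<le> B * (2 ^ m / (d powr \<alpha>)\<^sup>2) * p ^ n"
        by (simp add: norm_mult mult.assoc)
    qed
    with d sub show "\<exists>d>0. cball x d \<subseteq> unit_disk \<and>
        uniform_limit (cball x d) (\<lambda>N z. \<Sum>n<N. c n * K n z) g sequentially"
      by blast
  qed

  have "complex_of_real (v (w k)) * g (w k) = a k" for k
  proof -
    have v0: "complex_of_real (v (w k)) \<noteq> 0"
      using vpos[OF wD[of k]] by simp
    have "(\<lambda>n. c n * K n (w k)) sums (a k / complex_of_real (v (w k)))"
      using sums_divide[OF Mc[of k], of "complex_of_real (v (w k))"] v0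
      by (simp add: M_def mult.commute)
    then show ?thesis
      using v0 by (simp add: g_def sums_iff)
  qed
  moreover have "g \<in> growth_space v"
    unfolding growth_space_def using hol bound by blast
  ultimately show "\<exists>g\<in>growth_space (standard_weight \<alpha>). \<forall>n.
      complex_of_real (standard_weight \<alpha> (complex_of_real (1 - q ^ n))) *
      g (complex_of_real (1 - q ^ n)) = a n"
    unfolding v_def w_def by blast
qed

lemma pseudohyperbolic_commute: "pseudohyperbolic z w = pseudohyperbolic w z"
proof -
  have "cmod (1 - cnj z * w) = cmod (1 - cnj w * z)"
    using complex_mod_cnj[of "1 - cnj z * w"] by (simp add: mult.commute)
  then show ?thesis
    by (simp add: pseudohyperbolic_def norm_divide norm_minus_commute)
qed

lemma pseudohyperbolic_of_real_ge:
  assumes "0 \<le> x" "x \<le> y" "y < 1"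
  shows "pseudohyperbolic (complex_of_real x) (complex_of_real y) = (y - x) / (1 - x * y)"
proof -
  have "x * y < 1"
    using assms mult_left_le_one_le[of y x] by linarith
  have "(complex_of_real x - complex_of_real y) / (1 - cnj (complex_of_real x) * complex_of_real y)
      = complex_of_real ((x - y) / (1 - x * y))"
    by simp
  then have "pseudohyperbolic (complex_of_real x) (complex_of_real y) = \<bar>(x - y) / (1 - x * y)\<bar>"
    by (simp only: pseudohyperbolic_def norm_of_real)
  then show ?thesis
    using assms \<open>x * y < 1\<close> by simp
qed

lemma geometric_radial_separation:
  fixes q :: real
  assumes q: "0 < q" "q \<le> 1 / 2" and "n \<noteq> k"
  shows "1 / 3 \<le> pseudohyperbolic (complex_of_real (1 - q ^ n)) (complex_of_real (1 - q ^ k))"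
  using \<open>n \<noteq> k\<close>
proof (induction n k rule: linorder_wlog)
  case (le n k)
  then have "q ^ k \<le> q ^ Suc n"
    using q by (intro power_decreasing) auto
  also have "\<dots> \<le> q ^ n / 2"
    using q by simp
  finally have half: "q ^ k \<le> q ^ n / 2" .
  have pos: "0 < q ^ n" "0 < q ^ k" "q ^ n \<le> 1"
    using q by (auto intro: power_le_one)
  have eq: "1 - (1 - q ^ n) * (1 - q ^ k) = q ^ n + q ^ k - q ^ n * q ^ k"
    by (simp add: algebra_simps)
  have "q ^ n * q ^ k \<le> q ^ k"
    using pos by (simp add: mult_left_le_one_le)
  then have D: "0 < q ^ n + q ^ k - q ^ n * q ^ k"
    using pos by linarith
  have "(1 / 3) * (q ^ n + q ^ k - q ^ n * q ^ k) \<le> q ^ n - q ^ k"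
    using half mult_pos_pos[OF pos(1,2)] by (simp add: field_simps)
  then have "1 / 3 \<le> (q ^ n - q ^ k) / (q ^ n + q ^ k - q ^ n * q ^ k)"
    using D by (simp add: le_divide_eq)
  then show ?case
    using pseudohyperbolic_of_real_ge[of "1 - q ^ n" "1 - q ^ k"] pos half by (simp add: eq)
next
  case (sym n k)
  then show ?case
    using pseudohyperbolic_commute by metis
qed

theorem proposition2p6:
  fixes \<alpha> \<epsilon> :: real
  assumes "\<alpha> > 0" and "\<epsilon> > 0"
  shows "\<exists>z :: nat \<Rightarrow> complex. Bloch_interpolating (standard_weight \<alpha>) z \<and>
           separated z \<and> separation_constant z < \<epsilon>"
proof -
  define m where "m = nat \<lceil>2 * \<alpha>\<rceil>"
  have m: "2 * \<alpha> \<le> real m"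
    unfolding m_def by linarith
  \<comment> \<open>Chosen so that \<open>q powr \<alpha> = 2 powr -(m + 3)\<close>: this beats the constant \<open>2 ^ m\<close> of the peaks, and
    \<open>m \<ge> 2 * \<alpha>\<close> gives \<open>q \<le> 1 / 2\<close>, which the separation estimates use.\<close>
  define q :: real where "q = 2 powr (- (real m + 3) / \<alpha>)"
  have q: "0 < q" "q \<le> 1 / 2"
  proof -
    show "0 < q"
      by (simp add: q_def)
    have "- (real m + 3) / \<alpha> \<le> - 1"
      using m \<open>\<alpha> > 0\<close> by (simp add: divide_le_eq)
    then have "q \<le> 2 powr (- 1)"
      unfolding q_def by (intro powr_mono) auto
    then show "q \<le> 1 / 2"
      by (simp add: powr_minus)
  qed
  have "q powr \<alpha> = 2 powr (- real (m + 3))"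
    using \<open>\<alpha> > 0\<close> by (simp add: q_def powr_powr)
  also have "\<dots> = 1 / 2 ^ (m + 3)"
    by (simp only: powr_minus powr_realpow zero_less_numeral inverse_eq_divide)
  finally have p: "q powr \<alpha> = 1 / 2 ^ (m + 3)" .
  have "2 ^ m * (2 * q powr \<alpha> / (1 - q powr \<alpha>)) < 1"
  proof -
    have "1 \<le> (2 :: real) ^ m"
      by simp
    then have "2 * 2 ^ m < 8 * (2 :: real) ^ m - 1"
      by linarith
    then show ?thesis
      unfolding p by (simp add: field_simps power_add)
  qed
  define r where "r n = complex_of_real (1 - q ^ n)" for n
  have "growth_interpolating (standard_weight \<alpha>) r"
    unfolding r_def using \<open>2 ^ m * _ < 1\<close> q m \<open>\<alpha> > 0\<close>
    by (intro geometric_radial_growth_interpolating[of \<alpha> m q]) auto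
  from growth_interpolating_adjoin_near[OF this standard_weight_pos]
  obtain d where "0 < d" and d: "\<And>w. w \<noteq> 0 \<Longrightarrow> cmod w < d \<Longrightarrow>
      growth_interpolating (standard_weight \<alpha>) (case_nat w r)"
    by (auto simp: eventually_at r_def)
  \<comment> \<open>As \<open>r 0 = 0\<close> and all other points of \<open>r\<close> are at least \<open>1 / 2\<close>, a point \<open>t \<le> 1 / 4\<close> has \<open>0\<close>
    as its nearest point of \<open>r\<close> in the pseudohyperbolic distance, and this distance is \<open>t\<close>.\<close>
  define t where "t = Min {d / 2, \<epsilon> / 2, 1 / 4}"
  have t: "0 < t" "t < d" "t < \<epsilon>" "t \<le> 1 / 4"
    using \<open>0 < d\<close> \<open>\<epsilon> > 0\<close> by (auto simp: t_def)
  define z where "z = case_nat (complex_of_real t) r"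
  have interp: "growth_interpolating (standard_weight \<alpha>) z"
    unfolding z_def using t by (intro d) auto
  have t_r0: "pseudohyperbolic (complex_of_real t) (r 0) = t"
    using t by (simp add: pseudohyperbolic_def r_def)
  have t_r: "t \<le> pseudohyperbolic (complex_of_real t) (r n)" for n
  proof (cases n)
    case 0
    then show ?thesis
      using t_r0 by simp
  next
    case (Suc k)
    have "q ^ n \<le> q"
      unfolding Suc using q by (simp add: mult_left_le power_le_one)
    then have n: "1 / 2 \<le> 1 - q ^ n" "1 - q ^ n < 1"
      using q by auto
    have "t \<le> (1 - q ^ n) - t"
      using n t by linarith
    also have "\<dots> \<le> ((1 - q ^ n) - t) / (1 - t * (1 - q ^ n))"
    proof -
      have "0 \<le> t * (1 - q ^ n)" "t * (1 - q ^ n) \<le> t"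
        using t n by (auto simp: mult_left_le)
      then have "0 < 1 - t * (1 - q ^ n)" "1 - t * (1 - q ^ n) \<le> 1"
        using t by linarith+
      then show ?thesis
        using n t by (simp add: le_divide_eq mult_left_le)
    qed
    also have "\<dots> = pseudohyperbolic (complex_of_real t) (r n)"
      unfolding r_def using n t by (intro pseudohyperbolic_of_real_ge[symmetric]) auto
    finally show ?thesis .
  qed
  have sep: "t \<le> pseudohyperbolic (z n) (z k)" if "n \<noteq> k" for n k
  proof -
    have "t \<le> pseudohyperbolic (r i) (r j)" if "i \<noteq> j" for i j
      using geometric_radial_separation[OF q that] t by (simp add: r_def)
    with \<open>n \<noteq> k\<close> t_r pseudohyperbolic_commute show ?thesis
      by (auto simp: z_def split: nat.split)
  qed
  have "separated z"
    using interp sep t unfolding separated_def growth_interpolating_def by blast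
  moreover have "separation_constant z \<le> t"
    unfolding separation_constant_def
  proof (rule cInf_lower)
    show "t \<in> {pseudohyperbolic (z n) (z k) | n k. n \<noteq> k}"
      unfolding mem_Collect_eq using t_r0
      by (intro exI[of _ 0] exI[of _ "Suc 0"]) (simp add: z_def)
    show "bdd_below {pseudohyperbolic (z n) (z k) | n k. n \<noteq> k}"
      using sep by (auto intro!: bdd_belowI[of _ t])
  qed
  ultimately show ?thesis
    using growth_interpolating_imp_Bloch_interpolating[OF interp] t by force
qed

end
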